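(* Let $m_0\ge1$ be an integer, $t_p=\frac{2\pi p}{m_0}$ for $p=0,1,\dots,m_0-1$, and $0\le\alpha<\frac{2\pi}{m_0}$. Let $\mathbf{N}=(N_1,N_2)\in\mathbb{Z}^2$ and suppose that $m_0+n-ne^{\mathrm{i}m_0\alpha}\ne0$ for all integers $n$ with $N_1\le n\le N_1+m_0-1$. If $m_0\ge\frac{\mu(I^{\mathbf{N}})}{2}$, then every $f\in B_{\mathbf{N}}$ is exactly reconstructed by $$f(t)=\sum_{p=0}^{m_0-1}\bigl(f(\alpha+t_p)\,y_{1,\alpha}(t-t_p)+f'(t_p)\,y_{2,\alpha}(t-t_p)\bigr)\qquad\text{for all }t,$$ where, for $k=1,2$, $$y_{k,\alpha}(t-t_p)=\frac1{m_0}\sum_{n=N_1}^{N_1+m_0-1}v_{k,n,\alpha}(t)\,e^{-\mathrm{i}n\frac{2\pi p}{m_0}},$$ $$v_{1,n,\alpha}(t)=\frac{\left(m_0-n\left(e^{\mathrm{i}m_0t}-1\right)\right)e^{\mathrm{i}n(t-\alpha)}}{m_0+n-ne^{\mathrm{i}m_0\alpha}},\qquad v_{2,n,\alpha}(t)=\frac{\mathrm{i}\left(e^{\mathrm{i}(m_0\alpha+nt)}-e^{\mathrm{i}(m_0+n)t}\right)}{m_0+n-ne^{\mathrm{i}m_0\alpha}} .$$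
   Context: Here $\mathrm{i}$ is the imaginary unit. For $\mathbf{N}=(N_1,N_2)\in\mathbb{Z}^2$ with $N_1\le N_2$, $I^{\mathbf{N}}=\{n\in\mathbb{Z}: N_1\le n\le N_2\}$, $\mu(I^{\mathbf{N}})=N_2-N_1+1$ is its cardinality, and $B_{\mathbf{N}}$ is the set of all functions of the form $f(t)=\sum_{n\in I^{\mathbf{N}}}a(n)e^{\mathrm{i}nt}$ with $a(n)\in\mathbb{C}$. *)

theory Defs
  imports "HOL-Analysis.Analysis"
begin

definition freq_set :: "int \<times> int \<Rightarrow> int set" where
  "freq_set N = {n. fst N \<le> n \<and> n \<le> snd N}"

definition bandlimited :: "int \<times> int \<Rightarrow> (real \<Rightarrow> complex) set" where
  "bandlimited N =
     {f. \<exists>a :: int \<Rightarrow> complex. \<forall>t. f t = (\<Sum>n\<in>freq_set N. a n * exp (\<i> * of_int n * of_real t))}"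

definition node :: "nat \<Rightarrow> nat \<Rightarrow> real" where
  "node m p = 2 * pi * real p / real m"

definition v_denom :: "nat \<Rightarrow> real \<Rightarrow> int \<Rightarrow> complex" where
  "v_denom m \<alpha> n = of_nat m + of_int n - of_int n * exp (\<i> * of_nat m * of_real \<alpha>)"

definition v1 :: "nat \<Rightarrow> real \<Rightarrow> int \<Rightarrow> real \<Rightarrow> complex" where
  "v1 m \<alpha> n t =
     (of_nat m - of_int n * (exp (\<i> * of_nat m * of_real t) - 1))
       * exp (\<i> * of_int n * of_real (t - \<alpha>)) / v_denom m \<alpha> n"

definition v2 :: "nat \<Rightarrow> real \<Rightarrow> int \<Rightarrow> real \<Rightarrow> complex" where
  "v2 m \<alpha> n t =
     \<i> * (exp (\<i> * (of_nat m * of_real \<alpha> + of_int n * of_real t))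
          - exp (\<i> * (of_nat m + of_int n) * of_real t)) / v_denom m \<alpha> n"

text \<open>
  The source specifies y1 and y2 only through their translates: y(t - node m p) is (1/m) times
  the sum over n of v(t) exp(-i n 2 pi p / m), for all t and all p < m.
  The case p = 0 determines y and is taken as the definition; that the formula also holds for
  p > 0 is a property of the resulting functions and has to be proved.
\<close>

definition y1 :: "nat \<Rightarrow> int \<Rightarrow> real \<Rightarrow> real \<Rightarrow> complex" where
  "y1 m N1 \<alpha> s = 1 / of_nat m * (\<Sum>n = N1..N1 + int m - 1. v1 m \<alpha> n s)"

definition y2 :: "nat \<Rightarrow> int \<Rightarrow> real \<Rightarrow> real \<Rightarrow> complex" where
  "y2 m N1 \<alpha> s = 1 / of_nat m * (\<Sum>n = N1..N1 + int m - 1. v2 m \<alpha> n s)"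

end

(* By linearity it suffices to reconstruct a single exponential e^(ikt).  Since the spectrum
   has at most 2 m0 points, k = n or k = n + m0 for an n among the m0 frequencies
   N1, ..., N1 + m0 - 1.  Discrete orthogonality on the nodes reduces the sampling sum to
   e^(ik alpha) v1_n(t) + ik v2_n(t), which equals e^(ikt) in both cases: the functions v1, v2
   solve the 2 x 2 linear system given by these two conditions. *)

theory Submission
  imports Defs
begin

section \<open>Discrete orthogonality on the nodes\<close>

text \<open>The summands are the powers of an \<open>m\<close>-th root of unity \<open>z\<close>, so
  the sum is geometric: it vanishes unless \<open>z = 1\<close>, that is, unless \<open>m\<close>
  divides \<open>k\<close>.\<close>

lemma sum_exp_node:
  fixes m :: nat and k :: int
  assumes "m \<ge> 1"
  shows "(\<Sum>p<m. exp (\<i> * of_int k * of_real (node m p)))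
           = (if int m dvd k then of_nat m else 0)"
proof -
  define z where "z = exp (\<i> * of_int k * of_real (2 * pi / real m))"
  have pow: "exp (\<i> * of_int k * of_real (node m p)) = z ^ p" for p
    unfolding z_def node_def exp_of_nat_mult[symmetric] by (simp add: field_simps)
  have z_eq_1: "z = 1 \<longleftrightarrow> int m dvd k"
  proof
    assume "z = 1"
    then obtain l :: int where "of_int k * (2 * pi / real m) = of_int (2 * l) * pi"
      unfolding z_def exp_eq_1 by auto
    then have "of_int k = real m * real_of_int l"
      using assms by (simp add: field_simps)
    then have "real_of_int k = real_of_int (int m * l)" by simp
    then have "k = int m * l" by linarith
    then show "int m dvd k" by simp
  next
    assume "int m dvd k"
    then obtain l where "k = int m * l" by blast
    then show "z = 1"
      unfolding z_def exp_eq_1 using assms by (auto simp: field_simps)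
  qed
  have "z ^ m = exp (of_nat m * (\<i> * of_int k * of_real (2 * pi / real m)))"
    unfolding z_def by (rule exp_of_nat_mult[symmetric])
  also have "\<dots> = 1"
    unfolding exp_eq_1 using assms by (auto simp: field_simps)
  finally have "z ^ m = 1" .
  then show ?thesis
    unfolding pow by (auto simp: z_eq_1[symmetric] geometric_sum)
qed

lemma exp_period_node:
  assumes "m \<ge> 1"
  shows "exp (\<i> * of_nat m * of_real (node m p)) = 1"
  unfolding exp_eq_1 node_def using assms by (auto intro!: exI[of _ "int p"])

section \<open>Translates of the kernels and selection of a frequency\<close>

text \<open>The factor \<open>exp (\<i> * m * t)\<close> has period \<open>2 * pi / m\<close> and
  does not see a shift by a node; only the factor of frequency \<open>n\<close> picks up a
  phase.\<close>

lemma v1_shift: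
  assumes "m \<ge> 1"
  shows "v1 m \<alpha> n (t - node m p) = v1 m \<alpha> n t * exp (- \<i> * of_int n * of_real (node m p))"
proof -
  have "exp (\<i> * of_nat m * of_real (t - node m p)) = exp (\<i> * of_nat m * of_real t)"
    using exp_period_node[OF assms] by (simp add: right_diff_distrib exp_diff)
  moreover have "exp (\<i> * of_int n * of_real (t - node m p - \<alpha>)) =
      exp (\<i> * of_int n * of_real (t - \<alpha>)) * exp (- \<i> * of_int n * of_real (node m p))"
    unfolding exp_add[symmetric] by (simp add: algebra_simps)
  ultimately show ?thesis unfolding v1_def by simp
qed

lemma v2_shift:
  assumes "m \<ge> 1"
  shows "v2 m \<alpha> n (t - node m p) = v2 m \<alpha> n t * exp (- \<i> * of_int n * of_real (node m p))"
proof -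
  have "exp (\<i> * (of_nat m * of_real \<alpha> + of_int n * of_real (t - node m p))) =
      exp (\<i> * (of_nat m * of_real \<alpha> + of_int n * of_real t))
        * exp (- \<i> * of_int n * of_real (node m p))"
    unfolding exp_add[symmetric] by (simp add: algebra_simps)
  moreover have "exp (\<i> * (of_nat m + of_int n) * of_real (t - node m p)) =
      exp (\<i> * (of_nat m + of_int n) * of_real t) * exp (- \<i> * of_int n * of_real (node m p))"
  proof -
    \<comment> \<open>The shift produces a phase of frequency \<open>m + n\<close>. Multiplying by
      the exponential of frequency \<open>m\<close> at the node, which equals 1, reduces it to
      frequency \<open>n\<close>.\<close>
    have "exp (\<i> * (of_nat m + of_int n) * of_real (t - node m p))
            * exp (\<i> * of_nat m * of_real (node m p)) =
        exp (\<i> * (of_nat m + of_int n) * of_real t) * exp (- \<i> * of_int n * of_real (node m p))"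
      unfolding exp_add[symmetric] by (simp add: algebra_simps)
    then show ?thesis unfolding exp_period_node[OF assms] by simp
  qed
  ultimately show ?thesis
    unfolding v2_def by (simp only: left_diff_distrib mult.assoc times_divide_eq_left)
qed

text \<open>Bridges the definition of \<open>y1\<close>, which fixes only the untranslated kernel,
  and the form with node phases on which orthogonality acts.\<close>

lemma y1_shift:
  assumes "m \<ge> 1"
  shows "y1 m N \<alpha> (t - node m p) = 1 / of_nat m *
    (\<Sum>n = N..N + int m - 1. v1 m \<alpha> n t * exp (- \<i> * of_int n * of_real (node m p)))"
  unfolding y1_def v1_shift[OF assms] ..

lemma y2_shift:
  assumes "m \<ge> 1"
  shows "y2 m N \<alpha> (t - node m p) = 1 / of_nat m *
    (\<Sum>n = N..N + int m - 1. v2 m \<alpha> n t * exp (- \<i> * of_int n * of_real (node m p)))"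
  unfolding y2_def v2_shift[OF assms] ..

text \<open>The window \<open>{N..N + int m - 1}\<close> has exactly one representative of each
  residue class modulo \<open>m\<close>, so orthogonality removes every term but the one congruent
  to \<open>k\<close>. The frequency \<open>k\<close> itself may lie outside the window: on the
  nodes it cannot be told from \<open>n\<close>.\<close>

lemma node_sum_selects_frequency:
  fixes w :: "int \<Rightarrow> complex"
  assumes "m \<ge> 1" and n: "n \<in> {N..N + int m - 1}" and "int m dvd k - n"
  shows "(\<Sum>p<m. exp (\<i> * of_int k * of_real (node m p)) *
           (1 / of_nat m * (\<Sum>l = N..N + int m - 1. w l * exp (- \<i> * of_int l * of_real (node m p)))))
         = w n"
proof -
  have dvd_iff: "int m dvd k - l \<longleftrightarrow> l = n" if "l \<in> {N..N + int m - 1}" for l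
  proof
    assume "int m dvd k - l"
    with assms(3) have "int m dvd (k - n) - (k - l)" by (rule dvd_diff)
    then have "int m dvd l - n" by simp
    \<comment> \<open>Two indices of the window differ by less than \<open>m\<close>, so congruent
      ones coincide.\<close>
    moreover have "\<bar>l - n\<bar> < int m" using n that by auto
    ultimately have "l - n = 0" using zdvd_imp_le[of "int m" "\<bar>l - n\<bar>"] by fastforce
    then show "l = n" by simp
  qed (use assms(3) in simp)
  have "(\<Sum>p<m. exp (\<i> * of_int k * of_real (node m p)) *
           (1 / of_nat m * (\<Sum>l = N..N + int m - 1. w l * exp (- \<i> * of_int l * of_real (node m p)))))
      = (\<Sum>p<m. \<Sum>l = N..N + int m - 1.
           w l / of_nat m * exp (\<i> * of_int (k - l) * of_real (node m p)))"
    by (simp add: sum_distrib_left left_diff_distrib right_diff_distrib exp_diff exp_minus field_simps)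
  also have "\<dots> = (\<Sum>l = N..N + int m - 1.
      w l / of_nat m * (\<Sum>p<m. exp (\<i> * of_int (k - l) * of_real (node m p))))"
    by (subst sum.swap) (simp add: sum_distrib_left)
  also have "\<dots> = (\<Sum>l = N..N + int m - 1. if l = n then w l else 0)"
    unfolding sum_exp_node[OF assms(1)] using assms(1)
    by (intro sum.cong) (auto simp: dvd_iff)
  also have "\<dots> = w n" using n by simp
  finally show ?thesis .
qed

section \<open>The 2 x 2 system solved by \<open>v1\<close> and \<open>v2\<close>\<close>

text \<open>Up to the nonzero factor \<open>\<i> * exp (\<i> * n * \<alpha>)\<close>,
  \<open>v_denom\<close> is the determinant of the system for the frequencies \<open>n\<close> and
  \<open>n + m\<close>, and \<open>v1\<close>, \<open>v2\<close> are its solution by Cramer's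
  rule.\<close>

lemma v_interpolates_low:
  assumes "v_denom m \<alpha> n \<noteq> 0"
  shows "exp (\<i> * of_int n * of_real \<alpha>) * v1 m \<alpha> n t + \<i> * of_int n * v2 m \<alpha> n t
           = exp (\<i> * of_int n * of_real t)"
proof -
  define A where "A = exp (\<i> * of_nat m * of_real \<alpha>)"
  define E where "E = exp (\<i> * of_nat m * of_real t)"
  define a where "a = exp (\<i> * of_int n * of_real \<alpha>)"
  define e where "e = exp (\<i> * of_int n * of_real t)"
  have D: "v_denom m \<alpha> n = of_nat m + of_int n - of_int n * A"
    unfolding v_denom_def A_def ..
  have "a \<noteq> 0" unfolding a_def by simp
  have v1: "v1 m \<alpha> n t = (of_nat m - of_int n * (E - 1)) * (e / a) / v_denom m \<alpha> n"
    unfolding v1_def E_def e_def a_def by (simp add: right_diff_distrib exp_diff)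
  have v2: "v2 m \<alpha> n t = \<i> * (A * e - E * e) / v_denom m \<alpha> n"
    unfolding v2_def E_def e_def A_def by (simp add: algebra_simps exp_add)
  have "a * v1 m \<alpha> n t + \<i> * of_int n * v2 m \<alpha> n t
      = ((of_nat m - of_int n * (E - 1)) * e - of_int n * (A * e - E * e)) / v_denom m \<alpha> n"
    unfolding v1 v2 using \<open>a \<noteq> 0\<close> by (simp add: add_divide_distrib diff_divide_distrib algebra_simps)
  \<comment> \<open>The terms containing \<open>E\<close> cancel.\<close>
  also have "\<dots> = e * v_denom m \<alpha> n / v_denom m \<alpha> n"
    unfolding D by (simp add: algebra_simps)
  also have "\<dots> = e" using assms by simp
  finally show ?thesis unfolding a_def e_def .
qed

text \<open>Second equation of the same system: passing from \<open>n\<close> to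
  \<open>n + m\<close> multiplies \<open>a\<close> by \<open>A\<close> and \<open>e\<close> by
  \<open>E\<close>.\<close>

lemma v_interpolates_high:
  assumes "v_denom m \<alpha> n \<noteq> 0" and k: "k = n + int m"
  shows "exp (\<i> * of_int k * of_real \<alpha>) * v1 m \<alpha> n t + \<i> * of_int k * v2 m \<alpha> n t
           = exp (\<i> * of_int k * of_real t)"
proof -
  define A where "A = exp (\<i> * of_nat m * of_real \<alpha>)"
  define E where "E = exp (\<i> * of_nat m * of_real t)"
  define a where "a = exp (\<i> * of_int n * of_real \<alpha>)"
  define e where "e = exp (\<i> * of_int n * of_real t)"
  have D: "v_denom m \<alpha> n = of_nat m + of_int n - of_int n * A"
    unfolding v_denom_def A_def ..
  have "a \<noteq> 0" unfolding a_def by simp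
  have v1: "v1 m \<alpha> n t = (of_nat m - of_int n * (E - 1)) * (e / a) / v_denom m \<alpha> n"
    unfolding v1_def E_def e_def a_def by (simp add: right_diff_distrib exp_diff)
  have v2: "v2 m \<alpha> n t = \<i> * (A * e - E * e) / v_denom m \<alpha> n"
    unfolding v2_def E_def e_def A_def by (simp add: algebra_simps exp_add)
  have exp_k: "exp (\<i> * of_int k * of_real \<alpha>) = a * A" "exp (\<i> * of_int k * of_real t) = e * E"
    unfolding k a_def A_def e_def E_def exp_add[symmetric] by (simp_all add: algebra_simps)
  have "a * A * v1 m \<alpha> n t + \<i> * of_int k * v2 m \<alpha> n t
      = (A * (of_nat m - of_int n * (E - 1)) * e - of_int k * (A * e - E * e)) / v_denom m \<alpha> n"
    unfolding v1 v2 using \<open>a \<noteq> 0\<close> by (simp add: add_divide_distrib diff_divide_distrib algebra_simps)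
  \<comment> \<open>This time the terms free of \<open>E\<close> cancel.\<close>
  also have "\<dots> = e * E * v_denom m \<alpha> n / v_denom m \<alpha> n"
    unfolding D k by (simp add: algebra_simps)
  also have "\<dots> = e * E" using assms by simp
  finally show ?thesis unfolding exp_k .
qed

section \<open>Reconstruction of exponentials and of their combinations\<close>

text \<open>Two consecutive windows of \<open>m\<close> frequencies are covered, because a shifted
  value and a derivative per node suffice to separate a frequency from its alias \<open>m\<close>
  higher.\<close>

lemma exp_reconstruction:
  fixes m :: nat and N k :: int
  assumes "m \<ge> 1"
    and denom: "\<And>n. N \<le> n \<Longrightarrow> n \<le> N + int m - 1 \<Longrightarrow> v_denom m \<alpha> n \<noteq> 0"
    and "N \<le> k" "k < N + 2 * int m"
  shows "(\<Sum>p<m. exp (\<i> * of_int k * of_real (\<alpha> + node m p)) * y1 m N \<alpha> (t - node m p)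
            + \<i> * of_int k * exp (\<i> * of_int k * of_real (node m p)) * y2 m N \<alpha> (t - node m p))
         = exp (\<i> * of_int k * of_real t)"
proof -
  \<comment> \<open>The representative of \<open>k\<close> in the first window; one subtraction of
    \<open>m\<close> is enough since \<open>k < N + 2 * int m\<close>.\<close>
  define n where "n = (if k < N + int m then k else k - int m)"
  have n: "n \<in> {N..N + int m - 1}" "int m dvd k - n"
    using assms by (auto simp: n_def)
  let ?e = "\<lambda>p. exp (\<i> * of_int k * of_real (node m p))"
  have "(\<Sum>p<m. exp (\<i> * of_int k * of_real (\<alpha> + node m p)) * y1 m N \<alpha> (t - node m p)
            + \<i> * of_int k * ?e p * y2 m N \<alpha> (t - node m p))
      = exp (\<i> * of_int k * of_real \<alpha>) * (\<Sum>p<m. ?e p * y1 m N \<alpha> (t - node m p))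
        + \<i> * of_int k * (\<Sum>p<m. ?e p * y2 m N \<alpha> (t - node m p))"
    unfolding sum_distrib_left sum.distrib[symmetric]
    by (intro sum.cong) (auto simp: distrib_left exp_add mult.assoc)
  also have "\<dots> = exp (\<i> * of_int k * of_real \<alpha>) * v1 m \<alpha> n t + \<i> * of_int k * v2 m \<alpha> n t"
    unfolding y1_shift[OF assms(1)] y2_shift[OF assms(1)]
      node_sum_selects_frequency[OF assms(1) n] ..
  also have "\<dots> = exp (\<i> * of_int k * of_real t)"
  proof (cases "k < N + int m")
    case True
    then have "n = k" by (simp add: n_def)
    then show ?thesis using v_interpolates_low denom n by auto
  next
    case False
    then have "k = n + int m" by (simp add: n_def)
    then show ?thesis using v_interpolates_high denom n by auto
  qed
  finally show ?thesis .
qed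

text \<open>Each exponential is differentiated over the complex numbers and then restricted to the
  real line. This expresses derivative samples through exponentials weighted by
  \<open>\<i> * k\<close>.\<close>

lemma vector_derivative_exp_sum:
  fixes a :: "int \<Rightarrow> complex"
  shows "vector_derivative (\<lambda>t::real. \<Sum>k\<in>S. a k * exp (\<i> * of_int k * of_real t)) (at x)
           = (\<Sum>k\<in>S. a k * (\<i> * of_int k * exp (\<i> * of_int k * of_real x)))"
proof (rule vector_derivative_at, rule has_vector_derivative_sum)
  fix k assume "k \<in> S"
  have "((\<lambda>z. a k * exp (\<i> * of_int k * z)) has_field_derivative
          a k * (\<i> * of_int k * exp (\<i> * of_int k * of_real x))) (at (of_real x))"
    by (auto intro!: derivative_eq_intros)
  then show "((\<lambda>t. a k * exp (\<i> * of_int k * of_real t)) has_vector_derivative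
      a k * (\<i> * of_int k * exp (\<i> * of_int k * of_real x))) (at x)"
    by (rule has_vector_derivative_real_field)
qed

theorem mainTheorem5:
  fixes m0 :: nat and \<alpha> :: real and N1 N2 :: int
  assumes "m0 \<ge> 1"
    and "0 \<le> \<alpha>" and "\<alpha> < 2 * pi / real m0"
    and "N1 \<le> N2"
    and "\<And>n::int. N1 \<le> n \<Longrightarrow> n \<le> N1 + int m0 - 1 \<Longrightarrow>
           of_nat m0 + of_int n - of_int n * exp (\<i> * of_nat m0 * of_real \<alpha>) \<noteq> (0::complex)"
    and "real m0 \<ge> real (card (freq_set (N1, N2))) / 2"
  shows "(\<forall>p<m0. \<forall>t::real.
            y1 m0 N1 \<alpha> (t - node m0 p) =
              1 / of_nat m0 * (\<Sum>n = N1..N1 + int m0 - 1.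
                v1 m0 \<alpha> n t * exp (- \<i> * of_int n * of_real (2 * pi * real p / real m0))) \<and>
            y2 m0 N1 \<alpha> (t - node m0 p) =
              1 / of_nat m0 * (\<Sum>n = N1..N1 + int m0 - 1.
                v2 m0 \<alpha> n t * exp (- \<i> * of_int n * of_real (2 * pi * real p / real m0))))
       \<and> (\<forall>f\<in>bandlimited (N1, N2). \<forall>t::real.
            f t = (\<Sum>p = 0..m0 - 1.
              f (\<alpha> + node m0 p) * y1 m0 N1 \<alpha> (t - node m0 p)
              + vector_derivative f (at (node m0 p)) * y2 m0 N1 \<alpha> (t - node m0 p)))"
proof (rule conjI)
  show "\<forall>p<m0. \<forall>t::real.
      y1 m0 N1 \<alpha> (t - node m0 p) =
        1 / of_nat m0 * (\<Sum>n = N1..N1 + int m0 - 1.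
          v1 m0 \<alpha> n t * exp (- \<i> * of_int n * of_real (2 * pi * real p / real m0))) \<and>
      y2 m0 N1 \<alpha> (t - node m0 p) =
        1 / of_nat m0 * (\<Sum>n = N1..N1 + int m0 - 1.
          v2 m0 \<alpha> n t * exp (- \<i> * of_int n * of_real (2 * pi * real p / real m0)))"
    unfolding y1_shift[OF assms(1)] y2_shift[OF assms(1)] by (simp add: node_def)
next
  have freq: "freq_set (N1, N2) = {N1..N2}" by (auto simp: freq_set_def)
  \<comment> \<open>The set has \<open>N2 - N1 + 1\<close> elements, at most \<open>2 * m0\<close>;
    the summand 1 makes the inequality strict.\<close>
  have "N2 < N1 + 2 * int m0" using assms(4,6) unfolding freq by simp
  then have recon: "(\<Sum>p<m0. exp (\<i> * of_int k * of_real (\<alpha> + node m0 p)) * y1 m0 N1 \<alpha> (t - node m0 p)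
        + \<i> * of_int k * exp (\<i> * of_int k * of_real (node m0 p)) * y2 m0 N1 \<alpha> (t - node m0 p))
      = exp (\<i> * of_int k * of_real t)" if "k \<in> {N1..N2}" for k t
    using that assms(5) by (intro exp_reconstruction[OF assms(1)]) (auto simp: v_denom_def)
  \<comment> \<open>Subtraction on naturals is truncated, so this rests on
    \<open>m0 \<ge> 1\<close>.\<close>
  have indices: "{0..m0 - 1} = {..<m0}" using assms(1) by auto
  show "\<forall>f\<in>bandlimited (N1, N2). \<forall>t::real.
      f t = (\<Sum>p = 0..m0 - 1.
        f (\<alpha> + node m0 p) * y1 m0 N1 \<alpha> (t - node m0 p)
        + vector_derivative f (at (node m0 p)) * y2 m0 N1 \<alpha> (t - node m0 p))"
  proof (intro ballI allI)
    fix f and t :: real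
    assume "f \<in> bandlimited (N1, N2)"
    then obtain a where f: "f = (\<lambda>t. \<Sum>k = N1..N2. a k * exp (\<i> * of_int k * of_real t))"
      unfolding bandlimited_def freq by auto
    \<comment> \<open>Linearity: each exponential is replaced by its sampling sum, and exchanging
      the two sums then reassembles the samples of \<open>f\<close> and of its derivative.\<close>
    have "f t = (\<Sum>k = N1..N2. a k * (\<Sum>p<m0.
        exp (\<i> * of_int k * of_real (\<alpha> + node m0 p)) * y1 m0 N1 \<alpha> (t - node m0 p)
        + \<i> * of_int k * exp (\<i> * of_int k * of_real (node m0 p)) * y2 m0 N1 \<alpha> (t - node m0 p)))"
      unfolding f by (intro sum.cong refl) (simp only: recon)
    also have "\<dots> = (\<Sum>p<m0. \<Sum>k = N1..N2.
        a k * exp (\<i> * of_int k * of_real (\<alpha> + node m0 p)) * y1 m0 N1 \<alpha> (t - node m0 p)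
        + a k * (\<i> * of_int k * exp (\<i> * of_int k * of_real (node m0 p))) * y2 m0 N1 \<alpha> (t - node m0 p))"
      unfolding sum_distrib_left by (subst sum.swap) (simp only: distrib_left mult.assoc)
    also have "\<dots> = (\<Sum>p = 0..m0 - 1.
        f (\<alpha> + node m0 p) * y1 m0 N1 \<alpha> (t - node m0 p)
        + vector_derivative f (at (node m0 p)) * y2 m0 N1 \<alpha> (t - node m0 p))"
      unfolding indices f vector_derivative_exp_sum sum_distrib_right sum.distrib ..
    finally show "f t = \<dots>" .
  qed
qed

end
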